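(* Given an arbitrary collection $\mathcal{S}:=\{S^i\}_{i=1}^d$ of finite sets and $n:=|\bigcup_{i=1}^dS^i|$, it is possible to determine whether $\mathrm{CDC}(\mathcal{S})$ admits a junction tree in time polynomial in $d$ and $n$.
   Context: Let $J:=\bigcup_{S\in\mathcal{S}}S$, $Q(S):=\{\lambda\in\mathbb{R}^J:\sum_{v\in J}\lambda_v=1,\ \lambda_{J\setminus S}=0,\ \lambda\ge 0\}$ and $\mathrm{CDC}(\mathcal{S}):=\bigcup_{S\in\mathcal{S}}Q(S)$ (the combinatorial disjunctive constraint represented by $\mathcal{S}$). For an edge $S^1S^2$ of a graph whose vertices are sets in $\mathcal{S}$, put $\mathrm{mid}(S^1S^2):=S^1\cap S^2$. A junction tree of $\mathrm{CDC}(\mathcal{S})$ is a tree with vertex set $\mathcal{S}$ such that for any $S^1,S^2\in\mathcal{S}$ the unique path $\mathcal{P}$ between them in the tree satisfies $S^1\cap S^2\subseteq S$ for every vertex $S$ of $\mathcal{P}$ and $S^1\cap S^2\subseteq\mathrm{mid}(e)$ for every edge $e$ of $\mathcal{P}$. $\mathrm{CDC}(\mathcal{S})$ admits a junction tree if such a tree exists. *)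

theory Defs
  imports Complex_Main "HOL-Computational_Algebra.Polynomial"
begin

section \<open>Combinatorial disjunctive constraints\<close>

text \<open>
  A vector of \<open>\<real>\<^sup>J\<close> with \<open>J = \<Union>\<S>\<close> is a function that vanishes outside \<open>J\<close>; in
  \<open>Q\<close> this is subsumed by vanishing outside \<open>S \<subseteq> J\<close>.
\<close>

definition Q :: "'a set set \<Rightarrow> 'a set \<Rightarrow> ('a \<Rightarrow> real) set" where
  "Q \<S> S = {l. (\<Sum>v\<in>\<Union>\<S>. l v) = 1 \<and> (\<forall>v. v \<notin> S \<longrightarrow> l v = 0) \<and> (\<forall>v. 0 \<le> l v)}"

definition CDC :: "'a set set \<Rightarrow> ('a \<Rightarrow> real) set" where
  "CDC \<S> = (\<Union>S\<in>\<S>. Q \<S> S)"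


section \<open>Trees\<close>

text \<open>
  An undirected simple graph is given by a vertex set \<open>V\<close> and a set \<open>E\<close> of two-element
  subsets of \<open>V\<close>; a path is a nonempty list of distinct vertices.
\<close>

definition simple_graph :: "'v set \<Rightarrow> 'v set set \<Rightarrow> bool" where
  "simple_graph V E \<longleftrightarrow> (\<forall>e\<in>E. \<exists>u\<in>V. \<exists>v\<in>V. u \<noteq> v \<and> e = {u, v})"

definition is_path :: "'v set \<Rightarrow> 'v set set \<Rightarrow> 'v list \<Rightarrow> bool" where
  "is_path V E p \<longleftrightarrow> p \<noteq> [] \<and> set p \<subseteq> V \<and> distinct p \<and>
     (\<forall>i. Suc i < length p \<longrightarrow> {p ! i, p ! Suc i} \<in> E)"

definition path_between :: "'v set \<Rightarrow> 'v set set \<Rightarrow> 'v \<Rightarrow> 'v list \<Rightarrow> 'v \<Rightarrow> bool" where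
  "path_between V E u p v \<longleftrightarrow> is_path V E p \<and> hd p = u \<and> last p = v"

definition is_cycle :: "'v set \<Rightarrow> 'v set set \<Rightarrow> 'v list \<Rightarrow> bool" where
  "is_cycle V E p \<longleftrightarrow> is_path V E p \<and> 3 \<le> length p \<and> {last p, hd p} \<in> E"

definition is_tree :: "'v set \<Rightarrow> 'v set set \<Rightarrow> bool" where
  "is_tree V E \<longleftrightarrow> simple_graph V E \<and> V \<noteq> {} \<and>
     (\<forall>u\<in>V. \<forall>v\<in>V. \<exists>p. path_between V E u p v) \<and> (\<nexists>p. is_cycle V E p)"


section \<open>Junction trees\<close>

definition mid :: "'a set \<Rightarrow> 'a set \<Rightarrow> 'a set" where
  "mid S1 S2 = S1 \<inter> S2"

text \<open>
  Junction trees of \<open>CDC \<S>\<close> depend on the representing collection \<open>\<S>\<close>, not only on the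
  set of vectors \<open>CDC \<S>\<close>, so \<open>\<S>\<close> is the argument. In a tree exactly one path joins two
  given vertices, so the quantifier over \<open>p\<close> ranges over a single path.
\<close>

definition junction_tree :: "'a set set \<Rightarrow> 'a set set set \<Rightarrow> bool" where
  "junction_tree \<S> E \<longleftrightarrow> is_tree \<S> E \<and>
     (\<forall>S1\<in>\<S>. \<forall>S2\<in>\<S>. \<forall>p. path_between \<S> E S1 p S2 \<longrightarrow>
        (\<forall>S\<in>set p. S1 \<inter> S2 \<subseteq> S) \<and>
        (\<forall>i. Suc i < length p \<longrightarrow> S1 \<inter> S2 \<subseteq> mid (p ! i) (p ! Suc i)))"

definition admits_junction_tree :: "'a set set \<Rightarrow> bool" where
  "admits_junction_tree \<S> \<longleftrightarrow> (\<exists>E. junction_tree \<S> E)"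


section \<open>Random access machines\<close>

text \<open>
  Time is measured on a random access machine with registers and a main memory, both
  holding natural numbers, programmed in structured form. Every instruction and every test
  costs one unit. Since the only arithmetic operations are addition and truncated
  subtraction, a word grows by at most one bit per step, so unit cost is polynomially
  equivalent to logarithmic cost and to Turing machine time (Cook and Reckhow, 1973);
  with a multiplication instruction this would fail.
\<close>

datatype ram =
    Skip
  | Const nat nat  \<comment> \<open>\<open>Const r k\<close>: \<open>R\<^sub>r := k\<close>\<close>
  | Add nat nat nat  \<comment> \<open>\<open>Add r a b\<close>: \<open>R\<^sub>r := R\<^sub>a + R\<^sub>b\<close>\<close>
  | Sub nat nat nat  \<comment> \<open>\<open>Sub r a b\<close>: \<open>R\<^sub>r := max 0 (R\<^sub>a - R\<^sub>b)\<close>\<close>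
  | Load nat nat  \<comment> \<open>\<open>Load r a\<close>: \<open>R\<^sub>r := M[R\<^sub>a]\<close>\<close>
  | Store nat nat  \<comment> \<open>\<open>Store a r\<close>: \<open>M[R\<^sub>a] := R\<^sub>r\<close>\<close>
  | Seq ram ram
  | IfNZ nat ram ram
  | WhileNZ nat ram

type_synonym ram_state = "(nat \<Rightarrow> nat) \<times> (nat \<Rightarrow> nat)"  \<comment> \<open>registers, memory\<close>

text \<open>
  \<open>run c s t s'\<close>: program \<open>c\<close>, started in state \<open>s\<close>, halts after exactly \<open>t\<close> steps in state \<open>s'\<close>.
\<close>

inductive run :: "ram \<Rightarrow> ram_state \<Rightarrow> nat \<Rightarrow> ram_state \<Rightarrow> bool" where
  run_Skip: "run Skip s 1 s"
| run_Const: "run (Const r k) (R, M) 1 (R(r := k), M)"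
| run_Add: "run (Add r a b) (R, M) 1 (R(r := R a + R b), M)"
| run_Sub: "run (Sub r a b) (R, M) 1 (R(r := R a - R b), M)"
| run_Load: "run (Load r a) (R, M) 1 (R(r := M (R a)), M)"
| run_Store: "run (Store a r) (R, M) 1 (R, M(R a := R r))"
| run_Seq: "run c1 s t1 s' \<Longrightarrow> run c2 s' t2 s'' \<Longrightarrow> run (Seq c1 c2) s (t1 + t2) s''"
| run_If_True: "R r \<noteq> 0 \<Longrightarrow> run c1 (R, M) t s' \<Longrightarrow> run (IfNZ r c1 c2) (R, M) (Suc t) s'"
| run_If_False: "R r = 0 \<Longrightarrow> run c2 (R, M) t s' \<Longrightarrow> run (IfNZ r c1 c2) (R, M) (Suc t) s'"
| run_While_False: "R r = 0 \<Longrightarrow> run (WhileNZ r c) (R, M) 1 (R, M)"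
| run_While_True: "R r \<noteq> 0 \<Longrightarrow> run c (R, M) t1 s' \<Longrightarrow> run (WhileNZ r c) s' t2 s'' \<Longrightarrow>
    run (WhileNZ r c) (R, M) (Suc (t1 + t2)) s''"

inductive_cases run_SkipE: "run Skip s t s'"
inductive_cases run_ConstE: "run (Const r k) s t s'"
inductive_cases run_AddE: "run (Add r a b) s t s'"
inductive_cases run_SubE: "run (Sub r a b) s t s'"
inductive_cases run_LoadE: "run (Load r a) s t s'"
inductive_cases run_StoreE: "run (Store a r) s t s'"
inductive_cases run_SeqE: "run (Seq c1 c2) s t s'"
inductive_cases run_IfE: "run (IfNZ r c1 c2) s t s'"
inductive_cases run_WhileE: "run (WhileNZ r c) s t s'"

lemma run_deterministic:
  "run c s t s' \<Longrightarrow> run c s u s'' \<Longrightarrow> t = u \<and> s' = s''"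
proof (induction arbitrary: u s'' rule: run.induct)
  case (run_Seq c1 s t1 s1 c2 t2 s2)
  from run_Seq.prems show ?case
  proof (rule run_SeqE)
    fix u1 m u2
    assume u: "u = u1 + u2" and "run c1 s u1 m" and c2: "run c2 m u2 s''"
    then have "t1 = u1" "s1 = m" using run_Seq.IH(1) by simp_all
    moreover from this c2 have "t2 = u2 \<and> s2 = s''" using run_Seq.IH(2) by simp
    ultimately show ?thesis using u by simp
  qed
next
  case (run_If_True R r c1 M t s1 c2)
  from run_If_True.prems show ?case
    by (rule run_IfE) (use run_If_True.hyps(1) run_If_True.IH in simp_all)
next
  case (run_If_False R r c2 M t s1 c1)
  from run_If_False.prems show ?case
    by (rule run_IfE) (use run_If_False.hyps(1) run_If_False.IH in simp_all)
next
  case (run_While_False R r c M)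
  from run_While_False.prems show ?case
    by (rule run_WhileE) (use run_While_False.hyps in simp_all)
next
  case (run_While_True R r c M t1 s1 t2 s2)
  from run_While_True.prems show ?case
  proof (rule run_WhileE)
    fix R' M' assume "(R, M) = (R', M')" "R' r = 0"
    then show ?thesis using run_While_True.hyps(1) by simp
  next
    fix R' M' u1 m u2
    assume eq: "(R, M) = (R', M')" and u: "u = Suc (u1 + u2)"
      and c1: "run c (R', M') u1 m" and c2: "run (WhileNZ r c) m u2 s''"
    have "t1 = u1 \<and> s1 = m" by (rule run_While_True.IH(1)) (simp only: eq c1)
    moreover from this c2 have "t2 = u2 \<and> s2 = s''" by (intro run_While_True.IH(2)) simp
    ultimately show ?thesis using u by simp
  qed
qed ((erule run_SkipE, simp) | (erule run_ConstE, simp) | (erule run_AddE, simp) | (erule run_SubE, simp)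
  | (erule run_LoadE, simp) | (erule run_StoreE, simp))+


section \<open>Input encoding and time bounds\<close>

text \<open>
  The instance is presented as its \<open>d \<times> n\<close> incidence matrix in row-major order, where \<open>vs\<close>
  lists the ground set: \<open>R\<^sub>0 = d\<close>, \<open>R\<^sub>1 = n\<close>, and cell \<open>i * n + j\<close> of the memory is 1 or 0
  according to whether element \<open>j\<close> belongs to set \<open>i\<close>. Everything else is 0. A program
  thus never sees the elements themselves, only their positions in \<open>vs\<close>.
\<close>

definition encode :: "'a set list \<Rightarrow> 'a list \<Rightarrow> ram_state" where
  "encode Ss vs =
     ((\<lambda>_. 0)(0 := length Ss, 1 := length vs),
      (\<lambda>k. if k < length Ss * length vs
           then of_bool (vs ! (k mod length vs) \<in> Ss ! (k div length vs)) else 0))"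

text \<open>A polynomial in two variables \<open>x, y\<close> is a polynomial in \<open>y\<close> with coefficients in \<open>\<nat>[x]\<close>.\<close>

definition poly2 :: "nat poly poly \<Rightarrow> nat \<Rightarrow> nat \<Rightarrow> nat" where
  "poly2 p x y = poly (poly p [:y:]) x"

end

theory Submission
  imports Defs
begin

text \<open>
  Call \<open>S\<close> an ear of \<open>\<S>\<close>, with witness \<open>T\<close>, if \<open>S \<inter> U \<subseteq> T\<close> for all other \<open>U \<in> \<S>\<close>. A leaf of
  a junction tree is an ear whose witness is its neighbour, and conversely an ear can be
  attached to its witness in any junction tree of the remaining sets. So a junction tree
  exists iff \<open>\<S>\<close> can be reduced to one set by removing ears successively. Removing an ear
  never spoils reducibility, hence the greedy algorithm decides it: \<open>d\<close> rounds, each of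
  which tests all pairs of sets and removes every ear found.
\<close>

section \<open>Ear elimination\<close>

text \<open>The input list may repeat a set, while the vertices of a junction tree are the distinct
  sets. Ears are therefore defined for indexed families: a repeated set is an ear with its copy as
  witness, so elimination discards copies by itself and the program never compares sets for
  equality. The obstacle to a greedy choice is that removing one ear can destroy another, when each
  is the only witness of the other. An exchange settles that case; otherwise the two removals
  commute up to a change of witness. The number of rounds comes from counting: a round that changes
  anything removes at least one of at most \<open>d\<close> indices, so after \<open>d\<close>
  rounds no ear is left.\<close>

definition ear :: "('i \<Rightarrow> 'a set) \<Rightarrow> 'i set \<Rightarrow> 'i \<Rightarrow> 'i \<Rightarrow> bool" where
  "ear f A i j \<longleftrightarrow> i \<in> A \<and> j \<in> A \<and> i \<noteq> j \<and> (\<forall>k\<in>A. k \<noteq> i \<longrightarrow> f i \<inter> f k \<subseteq> f j)"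

inductive reducible :: "('i \<Rightarrow> 'a set) \<Rightarrow> 'i set \<Rightarrow> bool" for f where
  single: "reducible f {i}"
| remove: "reducible f A" if "ear f A i j" "reducible f (A - {i})"

text \<open>Since \<open>f i \<inter> f k \<subseteq> f j\<close> is the same as
  \<open>f i \<inter> f k \<subseteq> f i \<inter> f j\<close>, ears depend only on intersections of
  distinct members. It serves both the exchange of two ears and the passage from indices to
  sets.\<close>

lemma reducible_transfer:
  assumes "reducible f A" "inj_on h A"
    and "\<And>i k. i \<in> A \<Longrightarrow> k \<in> A \<Longrightarrow> i \<noteq> k \<Longrightarrow> g (h i) \<inter> g (h k) = f i \<inter> f k"
  shows "reducible g (h ` A)"
  using assms
proof (induction rule: reducible.induct)
  case (single i)
  then show ?case by (simp add: reducible.single)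
next
  case (remove A i j)
  have i: "i \<in> A" "j \<in> A" "i \<noteq> j" and sub: "\<And>k. k \<in> A \<Longrightarrow> k \<noteq> i \<Longrightarrow> f i \<inter> f k \<subseteq> f j"
    using remove.hyps(1) by (auto simp: ear_def)
  have "ear g (h ` A) (h i) (h j)"
    unfolding ear_def
  proof (intro conjI ballI impI)
    fix k assume "k \<in> h ` A" "k \<noteq> h i"
    then obtain l where l: "l \<in> A" "k = h l" "l \<noteq> i" by auto
    have "g (h i) \<inter> g k = f i \<inter> f l" using remove.prems(2) i l by metis
    also have "\<dots> \<subseteq> f i \<inter> f j" using sub l by blast
    also have "\<dots> = g (h i) \<inter> g (h j)" using remove.prems(2) i by metis
    finally show "g (h i) \<inter> g k \<subseteq> g (h j)" by blast
  qed (use i remove.prems(1) in \<open>auto dest: inj_onD\<close>)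
  moreover have "reducible g (h ` (A - {i}))"
    using remove.prems by (intro remove.IH) (auto intro: inj_on_subset)
  then have "reducible g (h ` A - {h i})"
    using remove.prems(1) i by (simp add: inj_on_image_set_diff)
  ultimately show ?case by (rule reducible.remove)
qed

text \<open>If the witness of \<open>i\<close> is the removed \<open>a\<close>, the witness
  \<open>b\<close> of \<open>a\<close> takes over: \<open>f i \<inter> f k\<close> lies in
  \<open>f a \<inter> f k\<close> and hence in \<open>f b\<close>. This fails only for
  \<open>b = i\<close>.\<close>

lemma ear_remove_other:
  assumes "ear f A i j" "ear f A a b" "a \<noteq> i"
  shows "(\<exists>j. ear f (A - {a}) i j) \<or> (j = a \<and> b = i)"
proof (cases "j = a")
  case False
  then have "ear f (A - {a}) i j" using assms by (auto simp: ear_def)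
  then show ?thesis by blast
next
  case True
  show ?thesis
  proof (cases "b = i")
    case False
    have "ear f (A - {a}) i b"
      unfolding ear_def
    proof (intro conjI ballI impI)
      fix k assume k: "k \<in> A - {a}" "k \<noteq> i"
      then have "f i \<inter> f k \<subseteq> f a" "f a \<inter> f k \<subseteq> f b"
        using assms True by (auto simp: ear_def)
      then show "f i \<inter> f k \<subseteq> f b" by blast
    qed (use assms False in \<open>auto simp: ear_def\<close>)
    then show ?thesis by blast
  qed (use True in simp)
qed

text \<open>
  Two ears that are each other's only witness have the same intersection with every other
  set, so either of them may take the place of the other.
\<close>

lemma reducible_remove_ear:
  assumes "reducible f A" "ear f A i j"
  shows "reducible f (A - {i})"
  using assms
proof (induction arbitrary: i j rule: reducible.induct)
  case (single a)
  then show ?case by (auto simp: ear_def)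
next
  case (remove A a b)
  show ?case
  proof (cases "i = a")
    case True
    then show ?thesis using remove.hyps by simp
  next
    case False
    show ?thesis
    proof (cases "j = a \<and> b = i")
      case True
      define h where "h k = (if k = i then a else k)" for k
      have eq: "f a \<inter> f k = f i \<inter> f k" if "k \<in> A" "k \<noteq> a" "k \<noteq> i" for k
        using that remove.hyps(1) remove.prems True unfolding ear_def by blast
      have "reducible f (h ` (A - {a}))"
      proof (rule reducible_transfer[OF remove.hyps(2)])
        show "inj_on h (A - {a})" by (auto simp: inj_on_def h_def)
      qed (use eq in \<open>auto simp: h_def split: if_splits\<close>)
      moreover have "i \<in> A" "a \<in> A" using remove.hyps(1) remove.prems by (auto simp: ear_def)
      then have "h ` (A - {a}) = A - {i}" using False by (auto simp: h_def image_iff)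
      ultimately show ?thesis by simp
    next
      case nocycle: False
      \<comment> \<open>The removals commute here: \<open>i\<close> stays an ear without
        \<open>a\<close>, and \<open>a\<close> stays one without \<open>i\<close>.\<close>
      obtain j' where "ear f (A - {a}) i j'"
        using ear_remove_other[OF remove.prems remove.hyps(1)] False nocycle by metis
      then have red: "reducible f (A - {a} - {i})" by (rule remove.IH)
      obtain b' where "ear f (A - {i}) a b'"
        using ear_remove_other[OF remove.hyps(1) remove.prems] False nocycle by metis
      moreover have "A - {a} - {i} = A - {i} - {a}" by auto
      ultimately show ?thesis using red by (metis reducible.remove)
    qed
  qed
qed

lemma reducible_ear_iff: "ear f A i j \<Longrightarrow> reducible f A \<longleftrightarrow> reducible f (A - {i})"
  by (metis reducible.remove reducible_remove_ear)

lemma reducible_image: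
  assumes "finite A"
  shows "reducible f A \<longleftrightarrow> reducible (\<lambda>S. S) (f ` A)"
  using assms
proof (induction A rule: finite_psubset_induct)
  case (psubset A)
  show ?case
  proof (cases "inj_on f A")
    case True
    show ?thesis
    proof
      assume "reducible f A"
      then show "reducible (\<lambda>S. S) (f ` A)" by (rule reducible_transfer) (use True in auto)
    next
      assume "reducible (\<lambda>S. S) (f ` A)"
      then have "reducible f (inv_into A f ` f ` A)"
        by (rule reducible_transfer) (use True in \<open>auto intro: inj_on_inv_into\<close>)
      then show "reducible f A" using True by simp
    qed
  next
    case False
    then obtain i j where ij: "i \<in> A" "j \<in> A" "i \<noteq> j" "f i = f j" by (auto simp: inj_on_def)
    then have "ear f A i j" by (auto simp: ear_def)
    then have "reducible f A \<longleftrightarrow> reducible f (A - {i})" by (rule reducible_ear_iff)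
    also have "\<dots> \<longleftrightarrow> reducible (\<lambda>S. S) (f ` (A - {i}))"
      using ij by (intro psubset.IH) auto
    also have "f ` (A - {i}) = f ` A" using ij by (auto simp: image_iff)
    finally show ?thesis .
  qed
qed


section \<open>Leaves of junction trees\<close>

lemma is_path_successively:
  "is_path V E p \<longleftrightarrow>
    p \<noteq> [] \<and> set p \<subseteq> V \<and> distinct p \<and> successively (\<lambda>x y. {x, y} \<in> E) p"
  by (auto simp: is_path_def successively_conv_nth)

lemma is_path_rev: "is_path V E (rev p) \<longleftrightarrow> is_path V E p"
proof -
  have "successively (\<lambda>x y. {x, y} \<in> E) (rev p) \<longleftrightarrow> successively (\<lambda>x y. {x, y} \<in> E) p"
    by (simp add: successively_rev insert_commute)
  then show ?thesis by (simp add: is_path_successively)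
qed

lemma is_path_Cons:
  "is_path V E (x # p) \<longleftrightarrow>
    x \<in> V \<and> x \<notin> set p \<and> (p = [] \<or> {x, hd p} \<in> E \<and> is_path V E p)"
  by (cases p) (auto simp: is_path_successively)

text \<open>The middle of an edge is the intersection of its two ends, both of which lie on the
  path, so the vertex condition carries the edge condition with it.\<close>

lemma junction_tree_iff:
  "junction_tree V E \<longleftrightarrow> is_tree V E \<and>
    (\<forall>p. is_path V E p \<longrightarrow> (\<forall>S\<in>set p. hd p \<inter> last p \<subseteq> S))"
  (is "_ \<longleftrightarrow> ?R")
proof
  assume J: "junction_tree V E"
  show ?R
  proof (intro conjI allI impI ballI)
    show "is_tree V E" using J by (simp add: junction_tree_def)
    fix p S assume p: "is_path V E p" "S \<in> set p"
    then have "hd p \<in> V" "last p \<in> V" by (auto simp: is_path_def)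
    then show "hd p \<inter> last p \<subseteq> S" using J p by (auto simp: junction_tree_def path_between_def)
  qed
next
  assume R: ?R
  show "junction_tree V E"
    unfolding junction_tree_def mid_def path_between_def
  proof (intro conjI ballI allI impI)
    show "is_tree V E" using R by simp
  next
    fix S1 S2 p S assume "is_path V E p \<and> hd p = S1 \<and> last p = S2" "S \<in> set p"
    then show "S1 \<inter> S2 \<subseteq> S" using R by blast
  next
    fix S1 S2 p i assume *: "is_path V E p \<and> hd p = S1 \<and> last p = S2" "Suc i < length p"
    then have "p ! i \<in> set p" "p ! Suc i \<in> set p" by auto
    then show "S1 \<inter> S2 \<subseteq> p ! i \<inter> p ! Suc i" using R * by blast
  qed
qed

section \<open>Attaching a leaf \<open>S\<close> to a vertex \<open>T\<close>\<close>

context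
  fixes V :: "'v set" and E S T
  assumes leaf: "S \<notin> V" "T \<in> V" and graph: "simple_graph V E"
begin

lemma leaf_edge: "{S, x} \<in> insert {S, T} E \<longleftrightarrow> x = T"
  using leaf graph by (auto simp: simple_graph_def doubleton_eq_iff)

lemma other_edge: "x \<noteq> S \<Longrightarrow> y \<noteq> S \<Longrightarrow> {x, y} \<in> insert {S, T} E \<longleftrightarrow> {x, y} \<in> E"
  by (auto simp: doubleton_eq_iff)

lemma path_avoiding_leaf:
  "is_path V E p \<longleftrightarrow> is_path (insert S V) (insert {S, T} E) p \<and> S \<notin> set p"
proof -
  have "successively (\<lambda>x y. {x, y} \<in> insert {S, T} E) p \<longleftrightarrow> successively (\<lambda>x y. {x, y} \<in> E) p"
    if "S \<notin> set p"
    by (rule successively_cong) (use that other_edge in metis)+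
  then show ?thesis using leaf(1) by (auto simp: is_path_successively)
qed

lemma path_from_leaf:
  "is_path (insert S V) (insert {S, T} E) (S # p) \<longleftrightarrow> p = [] \<or> is_path V E p \<and> hd p = T"
  unfolding is_path_Cons leaf_edge using path_avoiding_leaf leaf(2) by (auto simp: is_path_def)

text \<open>An inner vertex of a path has two distinct neighbours, but \<open>S\<close> has only
  \<open>T\<close>. So \<open>S\<close> is an end, and reversal puts it first.\<close>

lemma path_through_leaf:
  assumes p: "is_path (insert S V) (insert {S, T} E) p" and "S \<in> set p"
  obtains q where "p = S # q" | q where "rev p = S # q"
proof -
  obtain xs ys where split: "p = xs @ S # ys" using assms(2) by (meson split_list)
  have "xs = [] \<or> ys = []"
  proof (rule ccontr)
    assume "\<not> ?thesis"
    then have ne: "xs \<noteq> []" "ys \<noteq> []" by auto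
    have "{last xs, S} \<in> insert {S, T} E" "{S, hd ys} \<in> insert {S, T} E"
      using p ne by (auto simp: split is_path_successively successively_append_iff successively_Cons)
    then have "last xs = T" "hd ys = T" by (metis insert_commute leaf_edge)+
    then have "T \<in> set xs \<inter> set ys" using ne by (metis IntI hd_in_set last_in_set)
    then show False using p by (auto simp: split is_path_def)
  qed
  then show ?thesis using that split by auto
qed

text \<open>With \<open>S\<close> in front, both its successor and the vertex closing the cycle
  would have to be \<open>T\<close>, although these are distinct.\<close>

lemma cycle_avoids_leaf:
  assumes "is_cycle (insert S V) (insert {S, T} E) p"
  shows "S \<notin> set p"
proof
  assume "S \<in> set p"
  have no: False if "is_cycle (insert S V) (insert {S, T} E) (S # q)" for q
  proof -
    have q: "q \<noteq> []" "2 \<le> length q" "{S, last q} \<in> insert {S, T} E"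
      using that by (auto simp: is_cycle_def insert_commute split: if_splits)
    then have "hd q = T" "last q = T" "distinct q"
      using that leaf_edge path_from_leaf by (auto simp: is_cycle_def is_path_def)
    then show False using q(1,2) by (cases q) (auto split: if_splits)
  qed
  have "is_cycle (insert S V) (insert {S, T} E) (rev p)"
    using assms by (auto simp: is_cycle_def is_path_rev hd_rev last_rev insert_commute)
  moreover obtain q where "p = S # q \<or> rev p = S # q"
    using path_through_leaf \<open>S \<in> set p\<close> assms unfolding is_cycle_def by metis
  ultimately show False using no assms by metis
qed

lemma is_tree_leaf: "is_tree (insert S V) (insert {S, T} E) \<longleftrightarrow> is_tree V E"
proof -
  let ?V = "insert S V" and ?E = "insert {S, T} E"
  have "simple_graph ?V ?E"
    unfolding simple_graph_def
  proof
    fix e assume "e \<in> ?E"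
    then show "\<exists>u\<in>?V. \<exists>v\<in>?V. u \<noteq> v \<and> e = {u, v}"
      using graph leaf unfolding simple_graph_def by (metis insert_iff)
  qed
  moreover have "is_cycle V E p \<longleftrightarrow> is_cycle ?V ?E p" for p
  proof -
    have "is_cycle V E p" if c: "is_cycle ?V ?E p"
    proof -
      have S: "S \<notin> set p" using cycle_avoids_leaf[OF c] .
      have "p \<noteq> []" using c by (auto simp: is_cycle_def)
      then have "last p \<noteq> S" "hd p \<noteq> S" using S by (metis last_in_set, metis hd_in_set)
      then show ?thesis
        using S c other_edge[of "last p" "hd p"] path_avoiding_leaf unfolding is_cycle_def by blast
    qed
    then show ?thesis by (auto simp: is_cycle_def path_avoiding_leaf)
  qed
  moreover have "(\<forall>u\<in>?V. \<forall>v\<in>?V. \<exists>p. path_between ?V ?E u p v) \<longleftrightarrow>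
      (\<forall>u\<in>V. \<forall>v\<in>V. \<exists>p. path_between V E u p v)"
  proof
    assume conn: "\<forall>u\<in>?V. \<forall>v\<in>?V. \<exists>p. path_between ?V ?E u p v"
    show "\<forall>u\<in>V. \<forall>v\<in>V. \<exists>p. path_between V E u p v"
    proof (intro ballI)
      fix u v assume uv: "u \<in> V" "v \<in> V"
      then obtain p where p: "is_path ?V ?E p" "hd p = u" "last p = v"
        using conn by (metis insertI2 path_between_def)
      \<comment> \<open>On a path, \<open>S\<close> can only be an end, and here both ends are in
        \<open>V\<close>.\<close>
      have "S \<notin> set p"
      proof
        assume "S \<in> set p"
        then obtain q where "p = S # q \<or> rev p = S # q"
          using path_through_leaf p by metis
        then show False using p uv leaf(1) by (metis hd_rev list.sel(1))
      qed
      then show "\<exists>p. path_between V E u p v" using p path_avoiding_leaf path_between_def by metis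
    qed
  next
    assume conn: "\<forall>u\<in>V. \<forall>v\<in>V. \<exists>p. path_between V E u p v"
    have old: "\<exists>p. path_between ?V ?E u p v" if "u \<in> V" "v \<in> V" for u v
      using conn that by (metis path_avoiding_leaf path_between_def)
    have new: "\<exists>p. path_between ?V ?E S p v" if v: "v \<in> V" for v
    proof -
      obtain p where "is_path V E p" "hd p = T" "last p = v"
        using conn leaf(2) v by (metis path_between_def)
      then have "path_between ?V ?E S (S # p) v"
        by (auto simp: path_between_def path_from_leaf is_path_def[of V E])
      then show ?thesis by blast
    qed
    have new': "\<exists>p. path_between ?V ?E v p S" if v: "v \<in> V" for v
      using new[OF v] by (metis path_between_def is_path_rev hd_rev last_rev)
    have "path_between ?V ?E S [S] S" by (simp add: path_between_def path_from_leaf)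
    then show "\<forall>u\<in>?V. \<forall>v\<in>?V. \<exists>p. path_between ?V ?E u p v"
      using old new new' by auto
  qed
  ultimately show ?thesis using leaf(2) graph unfolding is_tree_def by auto
qed

end

text \<open>This is where ears meet leaves. Every path from \<open>S\<close> to another
  \<open>U\<close> runs through \<open>T\<close>, which forces
  \<open>S \<inter> U \<subseteq> T\<close>. Conversely, this inclusion gives
  \<open>S \<inter> U \<subseteq> T \<inter> U\<close>, and the junction property of the smaller
  tree covers the path from \<open>T\<close> to \<open>U\<close>.\<close>

lemma junction_tree_leaf:
  assumes leaf: "S \<notin> V" "T \<in> V" and graph: "simple_graph V E"
  shows "junction_tree (insert S V) (insert {S, T} E) \<longleftrightarrow>
    junction_tree V E \<and> (\<forall>U\<in>V. S \<inter> U \<subseteq> T)" (is "?L \<longleftrightarrow> ?R")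
proof
  assume L: ?L
  then have tree: "is_tree V E" using is_tree_leaf[OF assms] by (simp add: junction_tree_iff)
  have "S \<inter> U \<subseteq> T" if U: "U \<in> V" for U
  proof -
    obtain p where p: "is_path V E p" "hd p = T" "last p = U"
      using tree leaf(2) U by (metis is_tree_def path_between_def)
    then have "is_path (insert S V) (insert {S, T} E) (S # p)"
      by (simp add: path_from_leaf[OF assms])
    then have "S \<inter> last (S # p) \<subseteq> T"
      using L p by (metis hd_in_set is_path_def junction_tree_iff list.sel(1) list.set_intros(2))
    then show ?thesis using p by (auto simp: is_path_def)
  qed
  moreover have "junction_tree V E"
    using L tree path_avoiding_leaf[OF assms] by (metis junction_tree_iff)
  ultimately show ?R by blast
next
  assume R: ?R
  show ?L
    unfolding junction_tree_iff
  proof (intro conjI allI impI ballI)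
    show "is_tree (insert S V) (insert {S, T} E)"
      using R is_tree_leaf[OF assms] by (simp add: junction_tree_iff)
    have from_leaf: "S \<inter> last (S # q) \<subseteq> U"
      if q: "is_path (insert S V) (insert {S, T} E) (S # q)" "U \<in> set (S # q)" for q U
    proof (cases "q = [] \<or> U = S")
      case False
      then have p: "is_path V E q" "hd q = T" "U \<in> set q"
        using q path_from_leaf[OF assms] by auto
      then have "last q \<in> V" by (auto simp: is_path_def)
      then have "S \<inter> last q \<subseteq> T \<inter> last q" using R by blast
      also have "\<dots> \<subseteq> U" using R p by (metis junction_tree_iff)
      finally show ?thesis using False by simp
    qed (use q in auto)
    fix p U assume p: "is_path (insert S V) (insert {S, T} E) p" "U \<in> set p"
    show "hd p \<inter> last p \<subseteq> U"
    proof (cases "S \<in> set p")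
      case True
      then consider q where "p = S # q" | q where "rev p = S # q"
        using path_through_leaf[OF assms] p(1) by metis
      then show ?thesis
      proof cases
        case 1
        then show ?thesis using from_leaf p by auto
      next
        case (2 q)
        then have "hd (rev p) \<inter> last (rev p) \<subseteq> U"
          using from_leaf p by (metis is_path_rev list.sel(1) set_rev)
        then show ?thesis by (simp add: hd_rev last_rev Int_commute)
      qed
    next
      case False
      then show ?thesis using R p path_avoiding_leaf[OF assms] by (metis junction_tree_iff)
    qed
  qed
qed

text \<open>The first vertex \<open>S\<close> of a longest path is a leaf: a second neighbour off
  the path would extend it, and one on the path would close a cycle.\<close>

lemma tree_leaf_exists:
  assumes fin: "finite V" and tree: "is_tree V E" and two: "a \<in> V" "b \<in> V" "a \<noteq> b"
  obtains S T F where "S \<in> V" "T \<in> V - {S}" "simple_graph (V - {S}) F" "E = insert {S, T} F"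
proof -
  have len: "length p \<le> card V" if "is_path V E p" for p
    using that fin by (metis card_mono distinct_card is_path_def)
  obtain p0 where p0: "is_path V E p0" "hd p0 = a" "last p0 = b"
    using tree two by (metis is_tree_def path_between_def)
  \<comment> \<open>The maximum exists because the vertices of a path are distinct, so its length is
    at most \<open>card V\<close>.\<close>
  define p where "p = arg_max length (is_path V E)"
  have p: "is_path V E p" and max: "\<And>q. is_path V E q \<Longrightarrow> length q \<le> length p"
    using arg_max_nat_lemma[of "is_path V E" p0 length "Suc (card V)"] p0 len
    unfolding p_def by (auto simp: less_Suc_eq_le)
  have "2 \<le> length p0" using p0 two(3) by (cases p0 rule: remdups_adj.cases) (auto simp: is_path_def)
  then have "2 \<le> length p" using max[OF p0(1)] by simp
  then obtain S T r where pr: "p = S # T # r"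
    using that by (cases p rule: remdups_adj.cases) auto
  have ST: "S \<in> V" "T \<in> V" "S \<noteq> T" "{S, T} \<in> E"
    using p by (auto simp: pr is_path_Cons)
  have nb: "x = T" if x: "{S, x} \<in> E" for x
  proof (rule ccontr)
    assume "x \<noteq> T"
    have xV: "x \<in> V" "x \<noteq> S"
      using x tree by (auto simp: is_tree_def simple_graph_def doubleton_eq_iff)
    have "x \<in> set p"
    proof (rule ccontr)
      assume "x \<notin> set p"
      then have "is_path V E (x # p)"
        using p x xV by (auto simp: is_path_Cons[of V E x] pr insert_commute)
      then show False using max by fastforce
    qed
    then have "x \<in> set r" using xV \<open>x \<noteq> T\<close> by (simp add: pr)
    then obtain ys zs where r: "r = ys @ x # zs" by (meson split_list)
    have "is_path V E (S # T # ys @ [x])"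
      using p unfolding pr r is_path_successively
      by (simp add: successively_Cons successively_append_iff hd_append split: if_splits)
    then have "is_cycle V E (S # T # ys @ [x])"
      using x by (simp add: is_cycle_def insert_commute)
    then show False using tree by (auto simp: is_tree_def)
  qed
  have "simple_graph (V - {S}) (E - {{S, T}})"
    unfolding simple_graph_def
  proof
    fix e assume e: "e \<in> E - {{S, T}}"
    then obtain u v where uv: "u \<in> V" "v \<in> V" "u \<noteq> v" "e = {u, v}"
      using tree unfolding is_tree_def simple_graph_def by blast
    have "u \<noteq> S" "v \<noteq> S" using nb e uv by (auto simp: insert_commute)
    then show "\<exists>u\<in>V - {S}. \<exists>v\<in>V - {S}. u \<noteq> v \<and> e = {u, v}" using uv by blast
  qed
  then show ?thesis using that ST by (metis DiffI insert_Diff singletonD)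
qed

section \<open>Equivalence of junction trees and ear elimination\<close>

lemma admits_junction_tree_iff_reducible:
  assumes "finite V"
  shows "admits_junction_tree V \<longleftrightarrow> reducible (\<lambda>S. S) V"
proof
  assume "reducible (\<lambda>S. S) V"
  then have "\<exists>E. junction_tree V E"
  proof (induction rule: reducible.induct)
    case (single S)
    have path: "is_path {S} {} p \<longleftrightarrow> p = [S]" for p
      by (cases p) (auto simp: is_path_Cons is_path_def[of _ _ "[]"])
    have "junction_tree {S} {}"
      by (auto simp: junction_tree_iff is_tree_def simple_graph_def is_cycle_def path
          path_between_def)
    then show ?case by blast
  next
    case (remove V S T)
    then obtain E where E: "junction_tree (V - {S}) E" by blast
    then have "simple_graph (V - {S}) E" by (auto simp: junction_tree_def is_tree_def)
    then have "junction_tree (insert S (V - {S})) (insert {S, T} E)"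
      using junction_tree_leaf[of S "V - {S}" T E] E remove.hyps(1) by (auto simp: ear_def)
    then show ?case using remove.hyps(1) by (auto simp: ear_def insert_absorb)
  qed
  then show "admits_junction_tree V" by (simp add: admits_junction_tree_def)
next
  assume "admits_junction_tree V"
  then show "reducible (\<lambda>S. S) V"
    using assms
  proof (induction "card V" arbitrary: V rule: less_induct)
    case less
    obtain E where E: "junction_tree V E" using less.prems by (auto simp: admits_junction_tree_def)
    then have tree: "is_tree V E" by (simp add: junction_tree_def)
    \<comment> \<open>Trees are nonempty, so pruning leaves ends at a single vertex, the base case
      of \<open>reducible\<close>. The empty collection satisfies neither side.\<close>
    then obtain a where a: "a \<in> V" by (auto simp: is_tree_def)
    show ?case
    proof (cases "V = {a}")
      case True
      then show ?thesis by (simp add: reducible.single)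
    next
      case False
      then obtain b where "b \<in> V" "b \<noteq> a" using a by auto
      then obtain S T F where F: "S \<in> V" "T \<in> V - {S}" "simple_graph (V - {S}) F"
          "E = insert {S, T} F"
        using tree_leaf_exists[OF less.prems(2) tree a] by metis
      have "junction_tree (V - {S}) F \<and> (\<forall>U\<in>V - {S}. S \<inter> U \<subseteq> T)"
        using junction_tree_leaf[of S "V - {S}" T F] F E by (simp add: insert_absorb)
      moreover from this have "reducible (\<lambda>S. S) (V - {S})"
        using less.prems(2)
        by (intro less.hyps[OF card_Diff1_less[OF less.prems(2) F(1)]])
          (auto simp: admits_junction_tree_def)
      ultimately show ?thesis using F by (intro reducible.remove[of _ V S T]) (auto simp: ear_def)
    qed
  qed
qed


section \<open>Greedy elimination\<close>

definition eliminate :: "('i \<Rightarrow> 'a set) \<Rightarrow> 'i \<Rightarrow> 'i \<Rightarrow> 'i set \<Rightarrow> 'i set" where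
  "eliminate f i j A = (if ear f A i j then A - {i} else A)"

text \<open>The indices run downwards to match the order in which the loops of the program visit
  them.\<close>

definition elimination_round :: "(nat \<Rightarrow> 'a set) \<Rightarrow> nat \<Rightarrow> nat set \<Rightarrow> nat set" where
  "elimination_round f d =
    fold (\<lambda>i. fold (\<lambda>j. eliminate f i j) (rev [0..<d])) (rev [0..<d])"

lemma fold_invariant:
  assumes "P x" "\<And>y x. P x \<Longrightarrow> P (g y x)"
  shows "P (fold g ys x)"
  using assms(1) by (induction ys arbitrary: x) (auto intro: assms(2))

lemma fold_decreasing:
  assumes "\<And>y A. g y A \<subseteq> A"
  shows "fold g ys A \<subseteq> A"
  using fold_invariant[where P = "\<lambda>B. B \<subseteq> A"] assms by (metis order_refl order_trans)

text \<open>What is lost in one step never comes back, so an unchanged result means that every step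
  was the identity on \<open>A\<close>.\<close>

lemma fold_decreasing_fixed:
  assumes dec: "\<And>y A. g y A \<subseteq> A" and "fold g ys A = A" "y \<in> set ys"
  shows "g y A = A"
  using assms(2,3)
proof (induction ys)
  case (Cons z zs)
  have "A \<subseteq> g z A"
    using Cons.prems(1) fold_decreasing[where g = g and ys = zs and A = "g z A"] dec by simp
  then have "g z A = A" using dec by blast
  then show ?case using Cons by auto
qed simp

text \<open>Each application that changes the set lowers its cardinality, so the iteration is
  stationary after \<open>card A\<close> steps.\<close>

lemma funpow_decreasing_fixed:
  assumes dec: "\<And>A. g A \<subseteq> A" and "finite A" "card A \<le> m"
  shows "g ((g ^^ m) A) = (g ^^ m) A"
  using assms(2,3)
proof (induction m arbitrary: A)
  case 0
  then show ?case using dec[of "{}"] by simp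
next
  case (Suc m)
  show ?case
  proof (cases "g A = A")
    case True
    then have "(g ^^ Suc m) A = A" by (induction m) auto
    then show ?thesis using True by simp
  next
    case False
    then have "card (g A) < card A" using dec Suc.prems by (intro psubset_card_mono) auto
    then have "g ((g ^^ m) (g A)) = (g ^^ m) (g A)"
      using Suc.prems dec by (intro Suc.IH) (auto intro: finite_subset)
    then show ?thesis by (simp add: funpow_Suc_right del: funpow.simps)
  qed
qed

lemma eliminate_subset: "eliminate f i j A \<subseteq> A"
  by (auto simp: eliminate_def)

lemma elimination_round_subset: "elimination_round f d A \<subseteq> A"
  unfolding elimination_round_def by (intro fold_decreasing eliminate_subset)

lemma reducible_elimination_round: "reducible f (elimination_round f d A) \<longleftrightarrow> reducible f A"
proof -
  have "reducible f (eliminate f i j B) \<longleftrightarrow> reducible f B" for i j B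
    using reducible_ear_iff[of f B i j] by (simp add: eliminate_def)
  then show ?thesis
    unfolding elimination_round_def
    by (intro fold_invariant[where P = "\<lambda>B. reducible f B \<longleftrightarrow> reducible f A"]) auto
qed

lemma elimination_round_fixed:
  assumes "elimination_round f d A = A" "A \<subseteq> {..<d}"
  shows "\<not> ear f A i j"
proof
  assume e: "ear f A i j"
  then have ij: "i < d" "j < d" "i \<in> A" using assms(2) by (auto simp: ear_def)
  have "fold (\<lambda>j. eliminate f i j) (rev [0..<d]) A = A"
    using assms(1) ij unfolding elimination_round_def
    by (intro fold_decreasing_fixed[where y = i and ys = "rev [0..<d]"
          and g = "\<lambda>i. fold (\<lambda>j. eliminate f i j) (rev [0..<d])"])
      (auto intro: fold_decreasing[OF eliminate_subset, THEN subsetD])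
  then have "eliminate f i j A = A"
    using ij by (intro fold_decreasing_fixed[where y = j and ys = "rev [0..<d]"
          and g = "eliminate f i"] eliminate_subset) auto
  then show False using e ij by (auto simp: eliminate_def)
qed

text \<open>Rounds preserve reducibility, and the final set has no ear, so it can only be reducible
  as a singleton.\<close>

lemma reducible_iff_greedy:
  "reducible f {..<d} \<longleftrightarrow> card ((elimination_round f d ^^ d) {..<d}) = 1"
proof -
  let ?g = "elimination_round f d"
  let ?A = "(?g ^^ d) {..<d}"
  have sub: "(?g ^^ m) {..<d} \<subseteq> {..<d}" for m
    by (induction m) (use elimination_round_subset in \<open>auto, blast\<close>)
  have "reducible f ((?g ^^ m) {..<d}) \<longleftrightarrow> reducible f {..<d}" for m
    by (induction m) (simp_all add: reducible_elimination_round)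
  moreover have "reducible f ?A \<longleftrightarrow> card ?A = 1"
  proof
    assume "reducible f ?A"
    then show "card ?A = 1"
    proof cases
      case (remove i j)
      moreover have "?g ?A = ?A" by (intro funpow_decreasing_fixed elimination_round_subset) auto
      ultimately show ?thesis using elimination_round_fixed sub by metis
    qed simp
  qed (auto simp: card_1_singleton_iff intro: reducible.single)
  ultimately show ?thesis by blast
qed


section \<open>Programs with time bounds\<close>

text \<open>The first argument of the postcondition is the part of the time budget \<open>T\<close> that is left.\<close>

definition wp :: "ram \<Rightarrow> nat \<Rightarrow> (nat \<Rightarrow> (nat \<Rightarrow> nat) \<Rightarrow> (nat \<Rightarrow> nat) \<Rightarrow> bool) \<Rightarrow>
    (nat \<Rightarrow> nat) \<Rightarrow> (nat \<Rightarrow> nat) \<Rightarrow> bool" where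
  "wp c T P R M \<longleftrightarrow> (\<exists>t R' M'. run c (R, M) t (R', M') \<and> t \<le> T \<and> P (T - t) R' M')"

lemma wpI: "run c (R, M) t (R', M') \<Longrightarrow> t \<le> T \<Longrightarrow> P (T - t) R' M' \<Longrightarrow> wp c T P R M"
  unfolding wp_def by blast

text \<open>Naming the remaining budget by \<open>T = Suc T'\<close> keeps truncated subtraction out
  of the time conditions that follow.\<close>

lemma wp_Skip:
  "1 \<le> T \<Longrightarrow> (\<And>T'. T = Suc T' \<Longrightarrow> P T' R M) \<Longrightarrow> wp Skip T P R M"
  by (rule wpI[OF run_Skip]) auto

lemma wp_Const:
  "1 \<le> T \<Longrightarrow> (\<And>T'. T = Suc T' \<Longrightarrow> P T' (R(r := k)) M) \<Longrightarrow> wp (Const r k) T P R M"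
  by (rule wpI[OF run_Const]) auto

lemma wp_Add:
  "1 \<le> T \<Longrightarrow> (\<And>T'. T = Suc T' \<Longrightarrow> P T' (R(r := R a + R b)) M) \<Longrightarrow> wp (Add r a b) T P R M"
  by (rule wpI[OF run_Add]) auto

lemma wp_Sub:
  "1 \<le> T \<Longrightarrow> (\<And>T'. T = Suc T' \<Longrightarrow> P T' (R(r := R a - R b)) M) \<Longrightarrow> wp (Sub r a b) T P R M"
  by (rule wpI[OF run_Sub]) auto

lemma wp_Load:
  "1 \<le> T \<Longrightarrow> (\<And>T'. T = Suc T' \<Longrightarrow> P T' (R(r := M (R a))) M) \<Longrightarrow> wp (Load r a) T P R M"
  by (rule wpI[OF run_Load]) auto

lemma wp_Store:
  "1 \<le> T \<Longrightarrow> (\<And>T'. T = Suc T' \<Longrightarrow> P T' R (M(R a := R r))) \<Longrightarrow> wp (Store a r) T P R M"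
  by (rule wpI[OF run_Store]) auto

lemma wp_Seq: "wp c1 T (\<lambda>T'. wp c2 T' P) R M \<Longrightarrow> wp (Seq c1 c2) T P R M"
proof -
  assume "wp c1 T (\<lambda>T'. wp c2 T' P) R M"
  then obtain t1 R1 M1 t2 R2 M2 where *: "run c1 (R, M) t1 (R1, M1)" "t1 \<le> T"
      "run c2 (R1, M1) t2 (R2, M2)" "t2 \<le> T - t1" "P (T - t1 - t2) R2 M2"
    unfolding wp_def by blast
  show ?thesis by (rule wpI[OF run_Seq[OF *(1,3)]]) (use * in auto)
qed

lemma wp_If:
  assumes "1 \<le> T"
    and "\<And>T'. T = Suc T' \<Longrightarrow> R r \<noteq> 0 \<Longrightarrow> wp c1 T' P R M"
    and "\<And>T'. T = Suc T' \<Longrightarrow> R r = 0 \<Longrightarrow> wp c2 T' P R M"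
  shows "wp (IfNZ r c1 c2) T P R M"
proof (cases "R r = 0")
  case True
  then obtain t R' M' where *: "run c2 (R, M) t (R', M')" "t \<le> T - 1" "P (T - 1 - t) R' M'"
    using assms(3)[of "T - 1"] assms(1) unfolding wp_def by auto
  show ?thesis by (rule wpI[OF run_If_False[OF True *(1)]]) (use * assms(1) in auto)
next
  case False
  then obtain t R' M' where *: "run c1 (R, M) t (R', M')" "t \<le> T - 1" "P (T - 1 - t) R' M'"
    using assms(2)[of "T - 1"] assms(1) unfolding wp_def by auto
  show ?thesis by (rule wpI[OF run_If_True[where r = r, OF False *(1)]]) (use * assms(1) in auto)
qed

lemma wp_mono:
  assumes "wp c T P R M" "T \<le> T'"
    and "\<And>S R M. P S R M \<Longrightarrow> P' (S + (T' - T)) R M"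
  shows "wp c T' P' R M"
proof -
  obtain t R' M' where *: "run c (R, M) t (R', M')" "t \<le> T" "P (T - t) R' M'"
    using assms(1) unfolding wp_def by blast
  have "T - t + (T' - T) = T' - t" using * assms(2) by simp
  then show ?thesis using assms(3)[OF *(3)] * assms(2) by (intro wpI[OF *(1)]) auto
qed

text \<open>
  Throughout, \<open>R\<^sub>2 = 1\<close> and \<open>R\<^sub>3 = 0\<close>, so that \<open>Add r a 3\<close> copies a register. Loops count
  down, since a loop test is a test for zero.
\<close>

definition For :: "nat \<Rightarrow> nat \<Rightarrow> ram \<Rightarrow> ram" where
  "For q a c = Seq (Add q a 3) (WhileNZ q (Seq (Sub q q 2) c))"

text \<open>The invariant carries an abstract value \<open>x\<close>, which the pass with counter
  \<open>k\<close> updates by \<open>g k\<close>; the loop thus computes a fold over descending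
  counters. Each pass pays 2 for test and decrement, and the final failing test costs 1.\<close>

lemma wp_While:
  assumes step: "\<And>k x R M. k < N \<Longrightarrow> I (Suc k) x R M \<Longrightarrow>
      wp c B (\<lambda>_. I k (g k x)) (R(q := k)) M"
    and counter: "\<And>k x R M. I k x R M \<Longrightarrow> R q = k \<and> R 2 = 1"
    and "I n x R M" "n \<le> N"
  shows "\<exists>t R' M'. run (WhileNZ q (Seq (Sub q q 2) c)) (R, M) t (R', M') \<and>
    t \<le> n * (B + 2) + 1 \<and> I 0 (fold g (rev [0..<n]) x) R' M'"
  using assms(3,4)
proof (induction n arbitrary: x R M)
  case 0
  then show ?case using counter run_While_False[of R q] by fastforce
next
  case (Suc k)
  have c: "R q = Suc k" "R 2 = 1" using counter Suc.prems(1) by auto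
  obtain t1 R1 M1 where 1: "run c (R(q := k), M) t1 (R1, M1)" "t1 \<le> B" "I k (g k x) R1 M1"
    using step[OF _ Suc.prems(1)] Suc.prems(2) unfolding wp_def by auto
  obtain t2 R2 M2 where 2: "run (WhileNZ q (Seq (Sub q q 2) c)) (R1, M1) t2 (R2, M2)"
      "t2 \<le> k * (B + 2) + 1" "I 0 (fold g (rev [0..<k]) (g k x)) R2 M2"
    using Suc.IH[OF 1(3)] Suc.prems(2) by auto
  have "run (Sub q q 2) (R, M) 1 (R(q := k), M)" using run_Sub[of q q 2 R M] c by simp
  then have "run (WhileNZ q (Seq (Sub q q 2) c)) (R, M) (Suc (1 + t1 + t2)) (R2, M2)"
    using c by (intro run_While_True[OF _ run_Seq[OF _ 1(1)] 2(1)]) auto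
  moreover have "Suc (1 + t1 + t2) \<le> Suc k * (B + 2) + 1" using 1 2 by simp
  ultimately show ?case using 2(3) by auto
qed

text \<open>The additional 2 pays for copying the bound and for the last test. As \<open>B\<close>
  only bounds the body, \<open>post\<close> gets a lower bound on the remaining budget.\<close>

lemma wp_For:
  assumes "\<And>k x R M. k < N \<Longrightarrow> I (Suc k) x R M \<Longrightarrow>
      wp c B (\<lambda>_. I k (g k x)) (R(q := k)) M"
    and "\<And>k x R M. I k x R M \<Longrightarrow> R q = k \<and> R 2 = 1"
    and "I N x (R(q := N)) M" "R 3 = 0" "R a = N"
    and time: "N * (B + 2) + 2 \<le> T"
    and post: "\<And>T' R' M'. T \<le> T' + N * (B + 2) + 2 \<Longrightarrow>
      I 0 (fold g (rev [0..<N]) x) R' M' \<Longrightarrow> P T' R' M'"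
  shows "wp (For q a c) T P R M"
proof -
  have "\<exists>t R' M'. run (WhileNZ q (Seq (Sub q q 2) c)) (R(q := N), M) t (R', M') \<and>
      t \<le> N * (B + 2) + 1 \<and> I 0 (fold g (rev [0..<N]) x) R' M'"
    by (rule wp_While[where N = N]) (fact assms order_refl)+
  then obtain t R' M' where *: "run (WhileNZ q (Seq (Sub q q 2) c)) (R(q := N), M) t (R', M')"
    "t \<le> N * (B + 2) + 1" "I 0 (fold g (rev [0..<N]) x) R' M'"
    by blast
  have "run (Add q a 3) (R, M) 1 (R(q := N), M)" using run_Add[of q a 3 R M] assms(4,5) by simp
  from run_Seq[OF this *(1)] show ?thesis
    unfolding For_def by (rule wpI) (use * time in \<open>auto intro!: post\<close>)
qed


section \<open>The program\<close>

text \<open>Without a multiplication instruction, the address \<open>i * n + v\<close> is computed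
  by repeated addition of register 1, which holds \<open>n\<close>.\<close>

definition fetch :: "nat \<Rightarrow> nat \<Rightarrow> nat \<Rightarrow> ram" where
  "fetch r i v = Seq (Add 12 v 3) (Seq (For 11 i (Add 12 12 1)) (Load r 12))"

text \<open>Each addition costs 3 including loop control; copy, loop overhead and load make up the
  4. Register 12 cannot hold the row, since it is overwritten before the row is read.\<close>

lemma wp_fetch:
  assumes "R 2 = 1" "R 3 = 0" "i \<noteq> 12" "3 * R i + 4 \<le> T"
    and "\<And>T'. T \<le> T' + 3 * R i + 4 \<Longrightarrow>
      P T' (R(11 := 0, 12 := R i * R 1 + R v, r := M (R i * R 1 + R v))) M"
  shows "wp (fetch r i v) T P R M"
  unfolding fetch_def
proof (intro wp_Seq wp_Add)
  let ?I = "\<lambda>k x R' M'. R' = R(11 := k, 12 := x) \<and> M' = M"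
  have sum: "fold (\<lambda>_. (+) c) (rev [0..<n]) x = n * c + x" for c n x :: nat
    by (induction n arbitrary: x) simp_all
  show "wp (For 11 i (Add 12 12 1)) T' (\<lambda>T'. wp (Load r 12) T' P) (R(12 := R v + R 3)) M"
    if "T = Suc T'" for T'
    by (rule wp_For[where I = ?I and g = "\<lambda>_. (+) (R 1)" and B = 1 and N = "R i" and x = "R v"])
      (use assms that in \<open>auto simp: sum fun_upd_twist intro!: wp_Add wp_Load\<close>)
qed (use assms in auto)

text \<open>
  Registers: \<open>5\<close>, \<open>6\<close>, \<open>7\<close> hold the indices \<open>i\<close>, \<open>j\<close>, \<open>k\<close> of three sets, \<open>8\<close> the position
  \<open>v\<close> of an element, \<open>9\<close> a flag, \<open>10\<close> the number of remaining sets; \<open>4\<close> counts the rounds.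
  After a fetch, \<open>12\<close> still holds the address, which a subsequent \<open>Store\<close> relies on.
  Cell \<open>d * n + i\<close> tells whether set \<open>i\<close> remains. It is fetched like the entry \<open>i\<close> of a
  row \<open>d\<close>, even if \<open>i \<ge> n\<close>.
\<close>

definition violation_test :: ram where
  "violation_test =
    Seq (fetch 13 0 7) (IfNZ 13
      (Seq (Sub 14 5 7) (Seq (Sub 15 7 5) (Seq (Add 14 14 15) (IfNZ 14
        (Seq (fetch 15 5 8) (IfNZ 15
          (Seq (fetch 16 7 8) (IfNZ 16
            (Seq (fetch 17 6 8) (IfNZ 17 Skip (Const 9 0)))
            Skip))
          Skip))
        Skip))))
      Skip)"

text \<open>The two truncated differences sum to zero iff the indices agree. Flag 9 starts at 0 so
  that every early exit rejects; it becomes 1 only for the loops, where a violation clears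
  it.\<close>

definition ear_test :: ram where
  "ear_test =
    Seq (fetch 13 0 5) (Seq (fetch 14 0 6) (Seq (Sub 15 5 6) (Seq (Sub 16 6 5) (Seq (Add 15 15 16)
      (Seq (Const 9 0)
        (IfNZ 13 (IfNZ 14 (IfNZ 15
          (Seq (Const 9 1) (For 7 0 (For 8 1 violation_test))) Skip) Skip) Skip))))))"

text \<open>The fetch only restores in register 12 the address of the mark of \<open>i\<close>,
  which the ear test has overwritten.\<close>

definition elimination_step :: ram where
  "elimination_step = Seq ear_test (IfNZ 9
    (Seq (fetch 13 0 5) (Seq (Store 12 3) (Sub 10 10 2))) Skip)"

text \<open>In the last branch the count in register 10 is at most 1, so it is itself the
  answer.\<close>

definition elimination :: ram where
  "elimination =
    Seq (Const 2 1) (Seq (Add 10 0 3) (Seq (For 5 0 (Seq (fetch 13 0 5) (Store 12 2)))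
      (Seq (For 4 0 (For 5 0 (For 6 0 elimination_step)))
        (Seq (Sub 13 10 2) (IfNZ 13 (Const 0 0) (Add 0 10 3))))))"

lemma neq_test: "(a \<le> b \<longrightarrow> b \<noteq> a) \<longleftrightarrow> a \<noteq> b" "a \<le> b \<and> b \<le> a \<longleftrightarrow> a = b"
  for a b :: nat
  by auto

lemma fold_conj:
  "fold (\<lambda>k b. b \<and> P k) (rev [0..<N]) b \<longleftrightarrow> b \<and> (\<forall>k<N. P k)"
  by (induction N arbitrary: b) (auto simp: less_Suc_eq)

lemma fold_funpow: "fold (\<lambda>_. g) xs x = (g ^^ length xs) x"
  by (induction xs arbitrary: x) (simp_all add: funpow_swap1)

lemma fold_insert: "fold insert (rev [0..<N]) A = A \<union> {..<N}"
  by (induction N arbitrary: A) auto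

section \<open>Correctness and running time of the program\<close>

locale instance_memory =
  fixes d n :: nat and vs :: "'a list" and f :: "nat \<Rightarrow> 'a set"
  assumes bounded: "i < d \<Longrightarrow> f i \<subseteq> set vs" and n_def: "n = length vs"
begin

definition stored :: "nat set \<Rightarrow> (nat \<Rightarrow> nat) \<Rightarrow> bool" where
  "stored A M \<longleftrightarrow> (\<forall>i<d. \<forall>v<n. M (i * n + v) = of_bool (vs ! v \<in> f i)) \<and>
     (\<forall>i<d. M (d * n + i) = of_bool (i \<in> A)) \<and> A \<subseteq> {..<d}"

definition base_regs :: "(nat \<Rightarrow> nat) \<Rightarrow> bool" where
  "base_regs R \<longleftrightarrow> R 0 = d \<and> R (Suc 0) = n \<and> R 2 = 1 \<and> R 3 = 0"

definition violation :: "nat set \<Rightarrow> nat \<Rightarrow> nat \<Rightarrow> nat \<Rightarrow> nat \<Rightarrow> bool" where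
  "violation A i j k v \<longleftrightarrow> k \<in> A \<and> k \<noteq> i \<and> vs ! v \<in> f i \<and> vs ! v \<in> f k \<and> vs ! v \<notin> f j"

lemma ear_iff:
  assumes "A \<subseteq> {..<d}"
  shows "ear f A i j \<longleftrightarrow> i \<in> A \<and> j \<in> A \<and> i \<noteq> j \<and> (\<forall>k<d. \<forall>v<n. \<not> violation A i j k v)"
    (is "_ \<longleftrightarrow> ?R")
proof
  assume "ear f A i j"
  then show ?R unfolding ear_def violation_def by blast
next
  assume R: ?R
  show "ear f A i j"
    unfolding ear_def
  proof (intro conjI ballI impI subsetI)
    fix k x assume k: "k \<in> A" "k \<noteq> i" and x: "x \<in> f i \<inter> f k"
    then have "x \<in> set vs" using bounded assms by blast
    then obtain v where "v < n" "x = vs ! v" by (auto simp: in_set_conv_nth n_def)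
    then show "x \<in> f j" using R k x assms unfolding violation_def by blast
  qed (use R in auto)
qed

text \<open>It separates the incidence matrix from the marks, which begin at address
  \<open>d * n\<close>.\<close>

lemma entry_less: "i < d \<Longrightarrow> v < n \<Longrightarrow> i * n + v < d * n"
proof -
  assume "i < d" "v < n"
  then have "i * n + v < Suc i * n" by simp
  also have "\<dots> \<le> d * n" using \<open>i < d\<close> by (intro mult_le_mono1) simp
  finally show ?thesis .
qed

lemma stored_update:
  assumes "stored A M" "i < d"
  shows "stored (A - {i}) (M(d * n + i := 0))" "stored (insert i A) (M(d * n + i := Suc 0))"
proof -
  have "a * n + v \<noteq> d * n + i" if "a < d" "v < n" for a v
    using entry_less[OF that] by simp
  then show "stored (A - {i}) (M(d * n + i := 0))" "stored (insert i A) (M(d * n + i := Suc 0))"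
    using assms by (simp_all add: stored_def) blast+
qed

text \<open>These are the constants, the counters of the outer loops and the count; the ear test may
  change all others.\<close>

definition ear_frame :: "(nat \<Rightarrow> nat) \<Rightarrow> (nat \<Rightarrow> nat) \<Rightarrow> bool" where
  "ear_frame R R' \<longleftrightarrow> (\<forall>r\<in>{0, Suc 0, 2, 3, 4, 5, 6, 10}. R' r = R r)"

text \<open>At most four fetches from rows up to \<open>d\<close> account for \<open>12 * d\<close>;
  the constant covers everything else.\<close>

lemma wp_violation_test:
  assumes "base_regs R" "stored A M" "R 5 = i" "R 6 = j" "R 7 = k" "R 8 = v"
    "i < d" "j < d" "k < d" "v < n"
    and "12 * d + 24 \<le> T"
    and "\<And>T' R'. ear_frame R R' \<Longrightarrow> R' 7 = k \<Longrightarrow> R' 8 = v \<Longrightarrow>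
      R' 9 = (if violation A i j k v then 0 else R 9) \<Longrightarrow> P T' R' M"
  shows "wp violation_test T P R M"
proof -
  have R: "R 0 = d" "R (Suc 0) = n" "R 2 = 1" "R 3 = 0"
    using assms(1) by (auto simp: base_regs_def)
  have M: "M (d * n + k) = of_bool (k \<in> A)" "M (i * n + v) = of_bool (vs ! v \<in> f i)"
    "M (j * n + v) = of_bool (vs ! v \<in> f j)" "M (k * n + v) = of_bool (vs ! v \<in> f k)"
    using assms(2,7-10) by (auto simp: stored_def)
  show ?thesis
    unfolding violation_test_def
    using assms(3-11)
    \<comment> \<open>Symbolic execution, one rule per instruction; the postcondition is proved at
      the end of each branch.\<close>
    by - ((rule wp_Seq wp_fetch wp_If wp_Skip wp_Const wp_Sub wp_Add;
        (simp add: R M neq_test split del: split_of_bool)?) |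
      (rule assms(12); simp add: ear_frame_def violation_def))+
qed

definition loop_time :: nat where
  "loop_time = d * (n * (12 * d + 26) + 4) + 2"

text \<open>The abstract value of both loops is the truth value of "no violation so far", held in
  register 9. A test can only clear it, so a pass acts as a conjunction.\<close>

lemma wp_violation_loop:
  assumes R: "base_regs R" "R 5 = i" "R 6 = j" "R 9 = 1" and st: "stored A M"
    and ij: "i < d" "j < d"
    and T: "loop_time \<le> T"
    and post: "\<And>T' R'. T \<le> T' + loop_time \<Longrightarrow> ear_frame R R' \<Longrightarrow>
      R' 9 = of_bool (\<forall>k<d. \<forall>v<n. \<not> violation A i j k v) \<Longrightarrow> P T' R' M"
  shows "wp (For 7 0 (For 8 1 violation_test)) T P R M"
proof -
  define I where "I k b R' M' \<longleftrightarrow> M' = M \<and> ear_frame R R' \<and> R' 7 = k \<and> R' 9 = of_bool b"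
    for k b and R' M' :: "nat \<Rightarrow> nat"
  have frame: "base_regs R'" "R' 5 = i" "R' 6 = j" if "ear_frame R R'" for R'
    using that R by (auto simp: ear_frame_def base_regs_def)
  define g where "g = (\<lambda>k b. b \<and> (\<forall>v<n. \<not> violation A i j k v))"
  have inner: "wp (For 8 1 violation_test) (n * (12 * d + 26) + 2) (\<lambda>_. I k (g k b)) R' M'"
    if k: "k < d" and R': "I k b R' M'" for k b R' M'
  proof (rule wp_For[where N = n and x = b and g = "\<lambda>v b. b \<and> \<not> violation A i j k v"
        and I = "\<lambda>v b R'' M'. I k b R'' M' \<and> R'' 8 = v" and B = "12 * d + 24"])
    fix v b R'' M''
    assume v: "v < n" and *: "I k b R'' M'' \<and> R'' 8 = Suc v"
    then have M: "M'' = M" and fr: "ear_frame R (R''(8 := v))"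
      and R'': "R'' 7 = k" "R'' 9 = of_bool b"
      by (auto simp: I_def ear_frame_def)
    show "wp violation_test (12 * d + 24)
        (\<lambda>_ R'' M'. I k (b \<and> \<not> violation A i j k v) R'' M' \<and> R'' 8 = v) (R''(8 := v)) M''"
      unfolding M
    proof (rule wp_violation_test[OF frame(1)[OF fr] st frame(2,3)[OF fr], where k = k and v = v])
      fix T' R3
      assume a: "ear_frame (R''(8 := v)) R3" "R3 7 = k" "R3 8 = v"
        "R3 9 = (if violation A i j k v then 0 else (R''(8 := v)) 9)"
      have "ear_frame R R3" using a(1) fr by (simp add: ear_frame_def)
      then show "I k (b \<and> \<not> violation A i j k v) R3 M \<and> R3 8 = v"
        using a(2-4) R''(2) by (simp add: I_def)
    qed (use ij k v R'' in simp_all)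
  next
    have "base_regs R'" using R' frame by (auto simp: I_def)
    then show "R' 3 = 0" "R' 1 = n" by (auto simp: base_regs_def)
    show "I k b (R'(8 := n)) M' \<and> (R'(8 := n)) 8 = n"
      using R' by (auto simp: I_def ear_frame_def)
  next
    fix v b R'' M'' assume *: "I k b R'' M'' \<and> R'' 8 = v"
    then have "base_regs R''" using frame by (simp add: I_def)
    then show "R'' 8 = v \<and> R'' 2 = 1" using * by (simp add: base_regs_def)
  qed (simp_all add: fold_conj g_def)
  show ?thesis
  proof (rule wp_For[where I = I and N = d and x = True and g = g and B = "n * (12 * d + 26) + 2"])
    fix k b R' M' assume "k < d" "I (Suc k) b R' M'"
    then show "wp (For 8 1 violation_test) (n * (12 * d + 26) + 2) (\<lambda>_. I k (g k b)) (R'(7 := k)) M'"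
      by (intro inner) (auto simp: I_def ear_frame_def)
  next
    fix T' R' M'
    assume "T \<le> T' + d * (n * (12 * d + 26) + 2 + 2) + 2"
      and I: "I 0 (fold g (rev [0..<d]) True) R' M'"
    then show "P T' R' M'"
      unfolding g_def fold_conj by (auto simp: I_def loop_time_def algebra_simps intro!: post)
  next
    fix k b R' M' assume *: "I k b R' M'"
    then have "base_regs R'" using frame by (simp add: I_def)
    then show "R' 7 = k \<and> R' 2 = 1" using * by (simp add: I_def base_regs_def)
  next
    show "I d True (R(7 := d)) M" using R(4) by (simp add: I_def ear_frame_def)
    show "R 3 = 0" "R 0 = d" using R(1) by (simp_all add: base_regs_def)
    show "d * (n * (12 * d + 26) + 2 + 2) + 2 \<le> T"
      using T by (simp add: loop_time_def algebra_simps)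
  qed
qed

lemma wp_ear_test:
  assumes "base_regs R" "R 5 = i" "R 6 = j" and st: "stored A M" and "i < d" "j < d"
    and "loop_time + 6 * d + 20 \<le> T"
    and post: "\<And>T' R'. T \<le> T' + loop_time + 6 * d + 20 \<Longrightarrow> ear_frame R R' \<Longrightarrow>
      R' 9 = of_bool (ear f A i j) \<Longrightarrow> P T' R' M"
  shows "wp ear_test T P R M"
proof -
  have R: "R 0 = d" "R (Suc 0) = n" "R 2 = 1" "R 3 = 0"
    using assms(1) by (auto simp: base_regs_def)
  have M: "M (d * n + i) = of_bool (i \<in> A)" "M (d * n + j) = of_bool (j \<in> A)"
    and A: "A \<subseteq> {..<d}"
    using assms(4-6) by (auto simp: stored_def)
  show ?thesis
    unfolding ear_test_def
    using assms(2,3,5-7)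
    by - ((rule wp_Seq wp_fetch wp_If wp_Skip wp_Const wp_Sub wp_Add;
        (simp add: R M neq_test split del: split_of_bool)?) |
      (rule wp_violation_loop[OF _ _ _ _ st, of _ i j, unfolded One_nat_def];
        (simp add: R base_regs_def)?) |
      (rule post; simp add: ear_frame_def ear_iff[OF A]))+
qed

definition good :: "nat set \<Rightarrow> (nat \<Rightarrow> nat) \<Rightarrow> (nat \<Rightarrow> nat) \<Rightarrow> bool" where
  "good A R M \<longleftrightarrow> base_regs R \<and> stored A M \<and> R 10 = card A"

text \<open>Beyond the ear test this leaves \<open>3 * d + 10\<close> for the branch, one fetch and
  the removal.\<close>

definition step_time :: nat where
  "step_time = loop_time + 9 * d + 30"

lemma wp_elimination_step:
  assumes g: "good A R M" and ij: "R 5 = i" "R 6 = j" "i < d" "j < d"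
  shows "wp elimination_step step_time
    (\<lambda>_ R' M'. (\<forall>r<Suc 6. R' r = R r) \<and> good (eliminate f i j A) R' M') R M"
proof -
  have R: "R 0 = d" "R (Suc 0) = n" "R 2 = 1" "R 3 = 0" "R 10 = card A" and st: "stored A M"
    and base: "base_regs R"
    using g by (auto simp: good_def base_regs_def)
  show ?thesis
    unfolding elimination_step_def
  proof (rule wp_Seq, rule wp_ear_test[OF base ij(1,2) st ij(3,4)])
    fix T' R'
    assume T': "step_time \<le> T' + loop_time + 6 * d + 20" and fr: "ear_frame R R'"
      and flag: "R' 9 = of_bool (ear f A i j)"
    have keep: "R' r = R r" if "r < 7" for r
    proof -
      have "r \<in> {0, Suc 0, 2, 3, 4, 5, 6, 10}" using that by auto
      then show ?thesis using fr unfolding ear_frame_def by blast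
    qed
    have R': "R' 0 = d" "R' (Suc 0) = n" "R' 2 = 1" "R' 3 = 0" "R' 5 = i" "R' 10 = card A"
      using keep R ij fr by (simp_all add: ear_frame_def)
    have time: "3 * d + 10 \<le> T'" using T' by (simp add: step_time_def)
    show "wp (IfNZ 9 (Seq (fetch 13 0 5) (Seq (Store 12 3) (Sub 10 10 2))) Skip) T'
      (\<lambda>_ R' M'. (\<forall>r<Suc 6. R' r = R r) \<and> good (eliminate f i j A) R' M') R' M"
    proof (cases "ear f A i j")
      case True
      then have "i \<in> A" "finite A"
        using st by (auto simp: ear_def stored_def intro: finite_subset)
      then have "card A - Suc 0 = card (A - {i})" by simp
      then show ?thesis
        using True time flag stored_update(1)[OF st ij(3)]
        by (intro wp_If wp_Seq wp_fetch wp_Store wp_Sub)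
          (auto simp: R' R keep good_def base_regs_def eliminate_def)
    next
      case False
      then show ?thesis
        using time flag st
        by (intro wp_If wp_Skip) (auto simp: R' R keep good_def base_regs_def eliminate_def)
    qed
  qed (simp add: step_time_def)
qed

text \<open>The counters 4, 5, 6 are numbered from the outermost loop inwards, so one inequality
  states the frame condition at every level: a loop on \<open>q\<close> keeps all registers below
  \<open>q\<close>, its body also \<open>q\<close> itself.\<close>

lemma wp_For_sets:
  assumes q: "q \<in> {4, 5, 6}" and g: "good A R M"
    and step: "\<And>k A R' M'. k < d \<Longrightarrow> \<forall>r<q. R' r = R r \<Longrightarrow> R' q = k \<Longrightarrow> good A R' M' \<Longrightarrow>
      wp c B (\<lambda>_ R'' M''. (\<forall>r<Suc q. R'' r = R' r) \<and> good (h k A) R'' M'') R' M'"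
    and T: "d * (B + 2) + 2 \<le> T"
    and post: "\<And>T' R' M'. T \<le> T' + d * (B + 2) + 2 \<Longrightarrow> \<forall>r<q. R' r = R r \<Longrightarrow>
      good (fold h (rev [0..<d]) A) R' M' \<Longrightarrow> P T' R' M'"
  shows "wp (For q 0 c) T P R M"
proof -
  define I where "I k A R' M' \<longleftrightarrow> (\<forall>r<q. R' r = R r) \<and> R' q = k \<and> good A R' M'" for k A R' M'
  have good_upd: "good A (R'(q := k)) M'" if "good A R' M'" for A R' M' k
    using that q by (auto simp: good_def base_regs_def)
  show ?thesis
  proof (rule wp_For[where I = I and N = d and x = A and g = h and B = B])
    fix k A R' M'
    assume k: "k < d" and I: "I (Suc k) A R' M'"
    have "wp c B (\<lambda>_ R'' M''. (\<forall>r<Suc q. R'' r = (R'(q := k)) r) \<and> good (h k A) R'' M'')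
        (R'(q := k)) M'"
      using I k by (intro step good_upd) (auto simp: I_def)
    then show "wp c B (\<lambda>_. I k (h k A)) (R'(q := k)) M'"
      by (rule wp_mono) (use I in \<open>auto simp: I_def less_Suc_eq\<close>)
  next
    fix k A R' M' assume "I k A R' M'"
    then show "R' q = k \<and> R' 2 = 1" by (simp add: I_def good_def base_regs_def)
  next
    show "I d A (R(q := d)) M" using good_upd[OF g] by (simp add: I_def)
    show "R 3 = 0" "R 0 = d" using g by (simp_all add: good_def base_regs_def)
  next
    fix T' R' M' assume "T \<le> T' + d * (B + 2) + 2" "I 0 (fold h (rev [0..<d]) A) R' M'"
    then show "P T' R' M'" by (intro post) (auto simp: I_def)
  qed (fact T)
qed

definition round_time :: nat where
  "round_time = d * (d * (step_time + 2) + 2 + 2) + 2"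

lemma wp_elimination_round:
  assumes g: "good A R M"
  shows "wp (For 5 0 (For 6 0 elimination_step)) round_time
    (\<lambda>_ R' M'. (\<forall>r<Suc 4. R' r = R r) \<and> good (elimination_round f d A) R' M') R M"
proof (rule wp_For_sets[OF _ g, where B = "d * (step_time + 2) + 2"
      and h = "\<lambda>i. fold (\<lambda>j. eliminate f i j) (rev [0..<d])"])
  fix i A R' M'
  assume i: "i < d" "R' 5 = i" and g': "good A R' M'"
  show "wp (For 6 0 elimination_step) (d * (step_time + 2) + 2)
    (\<lambda>_ R'' M''. (\<forall>r<Suc 5. R'' r = R' r) \<and>
      good (fold (\<lambda>j. eliminate f i j) (rev [0..<d]) A) R'' M'') R' M'"
  proof (rule wp_For_sets[OF _ g', where B = step_time and h = "eliminate f i"])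
    fix j A R'' M''
    assume "j < d" "\<forall>r<6. R'' r = R' r" "R'' 6 = j" "good A R'' M''"
    then show "wp elimination_step step_time
      (\<lambda>_ R3 M3. (\<forall>r<Suc 6. R3 r = R'' r) \<and> good (eliminate f i j A) R3 M3) R'' M''"
      using i by (intro wp_elimination_step) auto
  qed auto
qed (auto simp: round_time_def elimination_round_def)

definition total_time :: nat where
  "total_time = d * (3 * d + 7) + d * (round_time + 2) + 20"

lemma wp_elimination:
  assumes R: "R = (\<lambda>_. 0)(0 := d, 1 := n)" and st: "stored {} M"
  shows "wp elimination total_time (\<lambda>_ R' M'. R' 0 = (if reducible f {..<d} then 1 else 0)) R M"
proof -
  define R1 where "R1 = R(2 := 1, 10 := d)"
  have base: "base_regs R1" and R1: "R1 10 = d" by (auto simp: R1_def R base_regs_def)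
  define I where "I k A R' M' \<longleftrightarrow> base_regs R' \<and> R' 5 = k \<and> R' 10 = d \<and> stored A M'" for k A R' M'
  have init: "wp (Seq (fetch 13 0 5) (Store 12 2)) (3 * d + 5) (\<lambda>_. I k (insert k A)) (R'(5 := k)) M'"
    if k: "k < d" and I: "I (Suc k) A R' M'" for k A R' M'
  proof -
    have R': "R' 0 = d" "R' (Suc 0) = n" "R' 2 = 1" "R' 3 = 0" "R' 10 = d" and "stored A M'"
      using I by (auto simp: I_def base_regs_def)
    then show ?thesis
      using stored_update(2)[OF _ k]
      by (intro wp_Seq wp_fetch wp_Store) (auto simp: I_def base_regs_def)
  qed
  have rounds: "wp (For 4 0 (For 5 0 (For 6 0 elimination_step))) T
      (\<lambda>T'. wp (Seq (Sub 13 10 2) (IfNZ 13 (Const 0 0) (Add 0 10 3))) T'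
        (\<lambda>_ R' M'. R' 0 = (if reducible f {..<d} then 1 else 0))) R' M'"
    if T: "d * (round_time + 2) + 10 \<le> T" and g: "good {..<d} R' M'" for T R' M'
  \<comment> \<open>The update ignores the counter, so the fold is the \<open>d\<close>-fold iterate
    of a round.\<close>
  proof (rule wp_For_sets[OF _ g, where B = round_time and h = "\<lambda>_. elimination_round f d"])
    fix T' R'' M''
    assume T': "T \<le> T' + d * (round_time + 2) + 2"
      and "good (fold (\<lambda>_. elimination_round f d) (rev [0..<d]) {..<d}) R'' M''"
    then have R'': "R'' 10 = card ((elimination_round f d ^^ d) {..<d})" "R'' 2 = 1" "R'' 3 = 0"
      by (simp_all add: good_def base_regs_def fold_funpow)
    have "8 \<le> T'" using T T' by simp
    then show "wp (Seq (Sub 13 10 2) (IfNZ 13 (Const 0 0) (Add 0 10 3))) T'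
        (\<lambda>_ R' M'. R' 0 = (if reducible f {..<d} then 1 else 0)) R'' M''"
      by (intro wp_Seq wp_Sub wp_If wp_Const wp_Add) (auto simp: R'' reducible_iff_greedy)
  qed (use T wp_elimination_round in auto)
  have "wp (For 5 0 (Seq (fetch 13 0 5) (Store 12 2))) T
      (\<lambda>T'. wp (Seq (For 4 0 (For 5 0 (For 6 0 elimination_step)))
        (Seq (Sub 13 10 2) (IfNZ 13 (Const 0 0) (Add 0 10 3)))) T'
        (\<lambda>_ R' M'. R' 0 = (if reducible f {..<d} then 1 else 0))) R1 M"
    if T: "d * (3 * d + 7) + d * (round_time + 2) + 15 \<le> T" for T
  proof (rule wp_For[where I = I and N = d and B = "3 * d + 5" and g = insert and x = "{}"])
    fix T' R' M'
    assume T': "T \<le> T' + d * (3 * d + 5 + 2) + 2" and I: "I 0 (fold insert (rev [0..<d]) {}) R' M'"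
    have "good {..<d} R' M'" using I by (simp add: I_def good_def fold_insert)
    moreover have "d * (round_time + 2) + 10 \<le> T'" using T T' by (simp add: algebra_simps)
    ultimately show "wp (Seq (For 4 0 (For 5 0 (For 6 0 elimination_step)))
        (Seq (Sub 13 10 2) (IfNZ 13 (Const 0 0) (Add 0 10 3)))) T'
        (\<lambda>_ R' M'. R' 0 = (if reducible f {..<d} then 1 else 0)) R' M'"
      by (intro wp_Seq rounds)
  next
    show "I d {} (R1(5 := d)) M" "R1 3 = 0" "R1 0 = d"
      using base st R1 by (simp_all add: I_def base_regs_def)
    show "d * (3 * d + 5 + 2) + 2 \<le> T" using T by (simp add: algebra_simps)
  next
    fix k A R' M' assume "I k A R' M'"
    then show "R' 5 = k \<and> R' 2 = 1" by (simp add: I_def base_regs_def)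
  qed (fact init)
  note start = this
  \<comment> \<open>This is the form in which the rules for the first two instructions leave the
    registers.\<close>
  have R1': "R1 = R(2 := 1, 10 := (R(2 := 1)) 0 + (R(2 := 1)) 3)"
    by (simp add: R1_def R)
  show ?thesis
    unfolding elimination_def
    by (intro wp_Seq wp_Const wp_Add; (fold R1')?; (rule start)?) (simp_all add: total_time_def)
qed

end

section \<open>Polynomial bounds\<close>

definition is_poly2 :: "(nat \<Rightarrow> nat \<Rightarrow> nat) \<Rightarrow> bool" where
  "is_poly2 F \<longleftrightarrow> (\<exists>p. \<forall>x y. poly2 p x y = F x y)"

lemma is_poly2_const: "is_poly2 (\<lambda>_ _. c)"
  unfolding is_poly2_def by (rule exI[of _ "[:[:c:]:]"]) (simp add: poly2_def)

lemma is_poly2_fst: "is_poly2 (\<lambda>x _. x)"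
  unfolding is_poly2_def by (rule exI[of _ "[:[:0, 1:]:]"]) (simp add: poly2_def)

lemma is_poly2_snd: "is_poly2 (\<lambda>_ y. y)"
  unfolding is_poly2_def by (rule exI[of _ "[:0, 1:]"]) (simp add: poly2_def)

lemma is_poly2_add: "is_poly2 F \<Longrightarrow> is_poly2 G \<Longrightarrow> is_poly2 (\<lambda>x y. F x y + G x y)"
  unfolding is_poly2_def poly2_def by (metis poly_add)

lemma is_poly2_mult: "is_poly2 F \<Longrightarrow> is_poly2 G \<Longrightarrow> is_poly2 (\<lambda>x y. F x y * G x y)"
  unfolding is_poly2_def poly2_def by (metis poly_mult)

lemma is_poly2_total_time: "is_poly2 instance_memory.total_time"
proof -
  have eq: "instance_memory.total_time d n =
    d * (3 * d + 7) +
    d * (d * (d * (d * (n * (12 * d + 26) + 4) + 2 + 9 * d + 30 + 2) + 2 + 2) + 2 + 2) + 20"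
    for d n
  proof -
    \<comment> \<open>The bounds depend on \<open>d\<close> and \<open>n\<close> alone, but
      unfolding them requires an instance; a dummy one with empty sets exists for all
      \<open>d\<close> and \<open>n\<close>.\<close>
    interpret instance_memory d n "replicate n undefined" "\<lambda>_. {}" by unfold_locales auto
    show ?thesis by (simp add: total_time_def round_time_def step_time_def loop_time_def)
  qed
  show ?thesis
    unfolding eq[abs_def]
    by (intro is_poly2_add is_poly2_mult is_poly2_const is_poly2_fst is_poly2_snd)
qed

theorem corollary2:
  shows "\<exists>(prog :: ram) (p :: nat poly poly).
    \<forall>(Ss :: 'a set list) (vs :: 'a list) d n.
      (\<forall>S\<in>set Ss. finite S) \<longrightarrow>
      d = length Ss \<longrightarrow> n = card (\<Union>(set Ss)) \<longrightarrow>
      set vs = \<Union>(set Ss) \<longrightarrow> distinct vs \<longrightarrow>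
      (\<exists>t R M. run prog (encode Ss vs) t (R, M) \<and> t \<le> poly2 p d n \<and>
         R 0 = (if admits_junction_tree (set Ss) then 1 else 0))"
proof -
  obtain p where p: "\<And>d n. poly2 p d n = instance_memory.total_time d n"
    using is_poly2_total_time unfolding is_poly2_def by blast
  show ?thesis
  proof (intro exI[of _ elimination] exI[of _ p] allI impI)
    fix Ss :: "'a set list" and vs :: "'a list" and d n
    assume d: "d = length Ss" and n: "n = card (\<Union>(set Ss))"
      and vs: "set vs = \<Union>(set Ss)" "distinct vs"
    have n': "n = length vs" using n vs distinct_card by metis
    interpret instance_memory d n vs "(!) Ss"
      by unfold_locales (use d vs n' in auto)
    obtain R M where enc: "encode Ss vs = (R, M)" by (cases "encode Ss vs")
    have R: "R = (\<lambda>_. 0)(0 := d, 1 := n)" using enc d n' by (simp add: encode_def)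
    have "stored {} M"
      unfolding stored_def
    proof (intro conjI allI impI)
      fix i v assume iv: "i < d" "v < n"
      then have "(i * n + v) div n = i" "(i * n + v) mod n = v" by auto
      then show "M (i * n + v) = of_bool (vs ! v \<in> Ss ! i)"
        using enc entry_less[OF iv] d n' by (auto simp: encode_def)
    \<comment> \<open>Cells from \<open>d * n\<close> on are initially 0, which encodes the empty
      set of marks.\<close>
    qed (use enc d n' in \<open>auto simp: encode_def\<close>)
    from wp_elimination[OF R this]
    obtain t R' M' where run: "run elimination (R, M) t (R', M')" "t \<le> total_time"
        "R' 0 = (if reducible ((!) Ss) {..<d} then 1 else 0)"
      unfolding wp_def by blast
    \<comment> \<open>Here repetitions in \<open>Ss\<close> disappear.\<close>
    have "reducible ((!) Ss) {..<d} \<longleftrightarrow> reducible (\<lambda>S. S) ((!) Ss ` {..<d})"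
      by (rule reducible_image) simp
    also have "(!) Ss ` {..<d} = set Ss" by (auto simp: d set_conv_nth)
    also have "reducible (\<lambda>S. S) (set Ss) \<longleftrightarrow> admits_junction_tree (set Ss)"
      by (simp add: admits_junction_tree_iff_reducible)
    finally have "R' 0 = (if admits_junction_tree (set Ss) then 1 else 0)" using run(3) by simp
    then show "\<exists>t R M. run elimination (encode Ss vs) t (R, M) \<and> t \<le> poly2 p d n \<and>
         R 0 = (if admits_junction_tree (set Ss) then 1 else 0)"
      using run(1,2) unfolding p enc by blast
  qed
qed

end
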